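(* Let $H$ be an $r$-uniform hypergraph with maximum degree $\Delta\ge 2$ and fix $\delta>0$. If $p=p(n)$ satisfies $n^{-1/\Delta}\ll p\ll 1$, then \[ \phi(H,n,p,\delta)\asymp n^r p^{\Delta}\log(1/p), \] i.e. there are constants $0<c<C$ (independent of $n$) such that $c\,n^rp^\Delta\log(1/p)\le \phi(H,n,p,\delta)\le C\,n^rp^\Delta\log(1/p)$ for all sufficiently large $n$.
   Context: An edge-weighted $r$-graph $G$ on $[n]$ is a symmetric function $G:[n]^r\to[0,1]$ with $G(i_1,\dots,i_r)=0$ unless $i_1,\dots,i_r$ are distinct. $t(H,G)=n^{-|V(H)|}\sum_{x\in[n]^{V(H)}}\prod_{e\in E(H)}G(x_e)$. With $I_p(x)=x\log\frac xp+(1-x)\log\frac{1-x}{1-p}$, $I_p(G)=\sum_{1\le i_1<\dots<i_r\le n}I_p(G(i_1,\dots,i_r))$ and $\phi(H,n,p,\delta)=\inf\{I_p(G): t(H,G)\ge(1+\delta)p^{|E(H)|}\}$ over edge-weighted $r$-graphs $G$ on $[n]$. The degree of a vertex is the number of edges containing it. $f\ll g$ means $f/g\to0$ as $n\to\infty$. *)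

theory Defs
  imports Complex_Main "HOL-Library.FuncSet" "HOL-Library.Multiset" "HOL-Library.Extended_Real"
begin

definition uniform_hypergraph :: "nat \<Rightarrow> 'v set \<Rightarrow> 'v set set \<Rightarrow> bool" where
  "uniform_hypergraph r V E \<longleftrightarrow> finite V \<and> (\<forall>e\<in>E. e \<subseteq> V \<and> card e = r)"

definition vertex_degree :: "'v set set \<Rightarrow> 'v \<Rightarrow> nat" where
  "vertex_degree E v = card {e \<in> E. v \<in> e}"

(* The inserted 0 only matters for V = {}, where Max is unspecified. *)
definition max_degree :: "'v set \<Rightarrow> 'v set set \<Rightarrow> nat" where
  "max_degree V E = Max (insert 0 (vertex_degree E ` V))"

(* [n]^r, an r-tuple being a list of length r. *)
definition tuples :: "nat \<Rightarrow> nat \<Rightarrow> nat list set" where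
  "tuples n r = {xs. length xs = r \<and> set xs \<subseteq> {1..n}}"

(* Functions are total in HOL; values of G outside [n]^r are unconstrained, and neither
   hom_density nor graph_entropy below depends on them. *)
definition weighted_graph :: "nat \<Rightarrow> nat \<Rightarrow> (nat list \<Rightarrow> real) \<Rightarrow> bool" where
  "weighted_graph r n G \<longleftrightarrow>
     (\<forall>xs\<in>tuples n r. 0 \<le> G xs \<and> G xs \<le> 1) \<and>
     (\<forall>xs\<in>tuples n r. \<forall>ys\<in>tuples n r. mset xs = mset ys \<longrightarrow> G xs = G ys) \<and>
     (\<forall>xs\<in>tuples n r. \<not> distinct xs \<longrightarrow> G xs = 0)"

(* x_e lists the values of x on e in an arbitrary order of e; the order is immaterial for
   symmetric G. *)
definition edge_tuple :: "('v \<Rightarrow> nat) \<Rightarrow> 'v set \<Rightarrow> nat list" where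
  "edge_tuple x e = map x (SOME vs. distinct vs \<and> set vs = e)"

definition hom_density :: "'v set \<Rightarrow> 'v set set \<Rightarrow> nat \<Rightarrow> (nat list \<Rightarrow> real) \<Rightarrow> real" where
  "hom_density V E n G =
     (\<Sum>x \<in> V \<rightarrow>\<^sub>E {1..n}. \<Prod>e\<in>E. G (edge_tuple x e)) / real n ^ card V"

(* 0 log 0 = 0 holds automatically, since 0 * y = 0. *)
definition rel_entropy :: "real \<Rightarrow> real \<Rightarrow> real" where
  "rel_entropy p x = x * ln (x / p) + (1 - x) * ln ((1 - x) / (1 - p))"

definition graph_entropy :: "nat \<Rightarrow> nat \<Rightarrow> real \<Rightarrow> (nat list \<Rightarrow> real) \<Rightarrow> real" where
  "graph_entropy r n p G =
     (\<Sum>xs \<in> {xs \<in> tuples n r. sorted_wrt (<) xs}. rel_entropy p (G xs))"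

(* Extended-real valued, so that the infimum over an empty feasible set is \<infinity>. *)
definition phi :: "nat \<Rightarrow> 'v set \<Rightarrow> 'v set set \<Rightarrow> nat \<Rightarrow> real \<Rightarrow> real \<Rightarrow> ereal" where
  "phi r V E n p \<delta> =
     (INF G \<in> {G. weighted_graph r n G \<and> hom_density V E n G \<ge> (1 + \<delta>) * p ^ card E}.
        ereal (graph_entropy r n p G))"

definition much_less :: "(nat \<Rightarrow> real) \<Rightarrow> (nat \<Rightarrow> real) \<Rightarrow> bool" (infix "\<lless>" 50) where
  "f \<lless> g \<longleftrightarrow> (\<lambda>n. f n / g n) \<longlonglongrightarrow> 0"

end

theory Submission imports Defs
begin

text \<open>
  Upper bound: turn about \<open>n p\<^sup>\<Delta>\<close> vertices into hubs, i.e. give weight \<open>1\<close> to every edge meeting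
  them and weight \<open>p\<close> to all others. The maps sending a vertex of degree \<open>\<Delta>\<close> to a hub already
  contribute a large multiple of \<open>p\<close> to the power \<open>|E|\<close> to the density.

  Lower bound: Finner's inequality bounds the density of \<open>H\<close> in \<open>G\<close> by the \<open>|E|\<close>-th power of the
  \<open>L\<^sup>\<Delta>\<close>-norm of \<open>G\<close>. Hence the entries \<open>x\<close> of \<open>G\<close> that exceed \<open>p\<close> by a constant factor
  carry a constant fraction of \<open>n\<^sup>r p\<^sup>\<Delta>\<close> in the sum of \<open>x\<^sup>\<Delta>\<close>, and for these entries the
  entropy is at least a constant times \<open>x\<^sup>2 log (1/p)\<close>, where \<open>x\<^sup>2 \<ge> x\<^sup>\<Delta>\<close> because \<open>\<Delta> \<ge> 2\<close>.
\<close>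

section \<open>Finner's inequality on finite product spaces\<close>

text \<open>Weighted AM-GM: each \<open>t i\<close> has weight \<open>1/d\<close>, and the remaining
  weight \<open>1 - card D / d\<close> sits on the value 1. The right-hand side is this weighted
  mean, written so that it becomes 1 once the excesses \<open>t i - 1\<close> average out.\<close>

lemma prod_root_le_mean:
  fixes t :: "'i \<Rightarrow> real"
  assumes "finite D" "card D \<le> d" "0 < d" "\<And>i. i \<in> D \<Longrightarrow> 0 \<le> t i"
  shows "(\<Prod>i\<in>D. root d (t i)) \<le> 1 + (\<Sum>i\<in>D. t i - 1) / d"
proof -
  define A where "A = 1 + (\<Sum>i\<in>D. t i - 1) / d"
  have A_eq: "A = (1 - card D / d) + (\<Sum>i\<in>D. t i) / d"
    using assms(3) by (simp add: A_def sum_subtractf diff_divide_distrib)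
  have slack: "0 \<le> 1 - card D / real d"
    using assms by simp
  show ?thesis
  proof (cases "\<exists>i\<in>D. t i = 0")
    case True
    then have "(\<Prod>i\<in>D. root d (t i)) = 0"
      using assms(1) by (force intro!: prod_zero)
    moreover have "0 \<le> A"
      unfolding A_eq using slack assms by (intro add_nonneg_nonneg divide_nonneg_nonneg sum_nonneg) auto
    ultimately show ?thesis by (simp add: A_def)
  next
    case False
    then have tpos: "\<And>i. i \<in> D \<Longrightarrow> 0 < t i"
      using assms(4) by (metis order_le_less)
    have Apos: "0 < A"
    proof (cases "D = {}")
      case False
      then have "0 < (\<Sum>i\<in>D. t i)"
        using tpos assms(1) by (intro sum_pos) auto
      then show ?thesis unfolding A_eq using slack assms(3) by (intro add_nonneg_pos divide_pos_pos) auto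
    qed (simp add: A_def)
    have "(\<Sum>i\<in>D. ln (t i)) - card D * ln A = (\<Sum>i\<in>D. ln (t i) - ln A)"
      by (simp add: sum_subtractf)
    also have "\<dots> = (\<Sum>i\<in>D. ln (t i / A))"
      using tpos Apos by (intro sum.cong) (force simp: ln_div)+
    also have "\<dots> \<le> (\<Sum>i\<in>D. t i / A - 1)"
      using tpos Apos by (intro sum_mono ln_le_minus_one) simp
    finally have "((\<Sum>i\<in>D. ln (t i)) - card D * ln A) / d \<le> (\<Sum>i\<in>D. t i / A - 1) / d"
      by (intro divide_right_mono) auto
    \<comment> \<open>The same tangent-line bound as for the \<open>t i\<close>, now for the value 1
      carrying the leftover weight.\<close>
    moreover have "(1 - card D / d) * ln (1 / A) \<le> (1 - card D / d) * (1 / A - 1)"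
      using slack Apos by (intro mult_left_mono ln_le_minus_one) auto
    \<comment> \<open>The linear terms cancel because \<open>A\<close> is the weighted mean.\<close>
    moreover have "(\<Sum>i\<in>D. t i / A - 1) / d + (1 - card D / d) * (1 / A - 1) = 0"
    proof -
      have "(\<Sum>i\<in>D. t i) = d * (A - 1) + card D"
        using assms(3) by (simp add: A_eq field_simps)
      then show ?thesis
        using Apos assms(3)
        by (simp add: sum_subtractf sum_divide_distrib[symmetric]) (simp add: field_simps)
    qed
    ultimately have "((\<Sum>i\<in>D. ln (t i)) - card D * ln A) / d - (1 - card D / d) * ln A \<le> 0"
      using Apos by (simp add: ln_div)
    then have "(\<Sum>i\<in>D. ln (t i)) / d \<le> ln A"
      by (simp add: diff_divide_distrib algebra_simps)
    moreover have "ln (\<Prod>i\<in>D. root d (t i)) = (\<Sum>i\<in>D. ln (t i)) / d"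
      using assms(1,3) by (subst ln_prod) (auto dest: tpos simp: ln_root sum_divide_distrib)
    moreover have "0 < (\<Prod>i\<in>D. root d (t i))"
      using tpos assms(3) by (intro prod_pos) auto
    ultimately show ?thesis
      using Apos by (simp add: A_def flip: ln_le_cancel_iff)
  qed
qed

text \<open>Dividing every \<open>g i\<close> by its \<open>L^d\<close>-norm makes the average of
  \<open>g i a ^ d / N i\<close> equal to 1, so summing the pointwise AM-GM bound over
  \<open>S\<close> leaves exactly \<open>card S\<close>. Averages in place of sums are what permits
  fewer than \<open>d\<close> factors.\<close>

lemma Hoelder_average:
  fixes g :: "'i \<Rightarrow> 'a \<Rightarrow> real"
  assumes "finite D" "card D \<le> d" "0 < d" "finite S" "S \<noteq> {}"
    and nonneg: "\<And>i a. i \<in> D \<Longrightarrow> a \<in> S \<Longrightarrow> 0 \<le> g i a"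
  shows "(\<Sum>a\<in>S. \<Prod>i\<in>D. g i a) / card S \<le> (\<Prod>i\<in>D. root d ((\<Sum>a\<in>S. g i a ^ d) / card S))"
proof -
  define N where "N i = (\<Sum>a\<in>S. g i a ^ d) / card S" for i
  have cS: "0 < real (card S)"
    using assms by (simp add: card_gt_0_iff)
  have N0: "0 \<le> N i" if "i \<in> D" for i
    unfolding N_def using that nonneg by (intro divide_nonneg_nonneg sum_nonneg) auto
  show ?thesis
  \<comment> \<open>A vanishing norm cannot be divided by, but it forces \<open>g i\<close> to
    vanish on all of \<open>S\<close>, and the left-hand side with it.\<close>
  proof (cases "\<exists>i\<in>D. N i = 0")
    case True
    then obtain i where i: "i \<in> D" "N i = 0" by blast
    then have "(\<Sum>a\<in>S. g i a ^ d) = 0"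
      using cS by (simp add: N_def)
    then have "\<forall>a\<in>S. g i a ^ d = 0"
      using assms(4) nonneg i(1) by (subst (asm) sum_nonneg_eq_0_iff) auto
    then have "\<forall>a\<in>S. (\<Prod>i\<in>D. g i a) = 0"
      using i(1) assms(1) by auto
    then have "(\<Sum>a\<in>S. \<Prod>i\<in>D. g i a) / card S = 0"
      by simp
    also have "0 \<le> (\<Prod>i\<in>D. root d (N i))"
      using N0 assms(3) by (intro prod_nonneg real_root_ge_zero)
    finally show ?thesis by (simp add: N_def)
  next
    case False
    then have Npos: "\<And>i. i \<in> D \<Longrightarrow> 0 < N i"
      using N0 by (metis order_le_less)
    define R where "R = (\<Prod>i\<in>D. root d (N i))"
    have Rpos: "0 < R"
      unfolding R_def using Npos assms(3) by (intro prod_pos) auto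
    have "(\<Prod>i\<in>D. g i a) / R \<le> 1 + (\<Sum>i\<in>D. g i a ^ d / N i - 1) / d" if a: "a \<in> S" for a
    proof -
      have "(\<Prod>i\<in>D. g i a) / R = (\<Prod>i\<in>D. root d (g i a ^ d / N i))"
        unfolding R_def using nonneg a assms(3)
        by (simp add: prod_dividef[symmetric] real_root_divide real_root_power_cancel)
      also have "\<dots> \<le> 1 + (\<Sum>i\<in>D. g i a ^ d / N i - 1) / d"
        using assms a nonneg Npos
        by (intro prod_root_le_mean) (auto intro!: divide_nonneg_pos)
      finally show ?thesis .
    qed
    then have "(\<Sum>a\<in>S. (\<Prod>i\<in>D. g i a) / R) \<le> (\<Sum>a\<in>S. 1 + (\<Sum>i\<in>D. g i a ^ d / N i - 1) / d)"
      by (intro sum_mono) auto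
    also have "\<dots> = card S + (\<Sum>i\<in>D. (\<Sum>a\<in>S. g i a ^ d / N i - 1)) / d"
      by (simp add: sum.distrib sum_divide_distrib[symmetric] sum.swap[of _ S D])
    also have "(\<Sum>i\<in>D. (\<Sum>a\<in>S. g i a ^ d / N i - 1)) = (\<Sum>i\<in>D. 0)"
    proof (rule sum.cong)
      fix i assume "i \<in> D"
      have "(\<Sum>a\<in>S. g i a ^ d) = N i * card S"
        using cS by (simp add: N_def)
      then show "(\<Sum>a\<in>S. g i a ^ d / N i - 1) = 0"
        using Npos[OF \<open>i \<in> D\<close>] by (simp add: sum_subtractf sum_divide_distrib[symmetric])
    qed simp
    finally have "(\<Sum>a\<in>S. \<Prod>i\<in>D. g i a) / R \<le> card S"
      by (simp add: sum_divide_distrib)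
    then have "(\<Sum>a\<in>S. \<Prod>i\<in>D. g i a) / card S \<le> R"
      using Rpos cS by (simp add: field_simps)
    then show ?thesis by (simp add: R_def N_def)
  qed
qed

text \<open>The expectation under the uniform probability measure on \<open>S\<close> to the power
  \<open>V\<close>. With this normalisation, coordinates on which \<open>F\<close> does not depend
  can be averaged away at no cost, and \<open>hom_density\<close> has the same shape.\<close>

definition PiE_average :: "'v set \<Rightarrow> 'a set \<Rightarrow> (('v \<Rightarrow> 'a) \<Rightarrow> real) \<Rightarrow> real" where
  "PiE_average V S F = (\<Sum>x\<in>V \<rightarrow>\<^sub>E S. F x) / real (card S) ^ card V"

lemma sum_PiE_insert:
  fixes F :: "('v \<Rightarrow> 'a) \<Rightarrow> real"
  assumes "v \<notin> W"
  shows "(\<Sum>x\<in>insert v W \<rightarrow>\<^sub>E S. F x) = (\<Sum>x\<in>W \<rightarrow>\<^sub>E S. \<Sum>a\<in>S. F (x(v := a)))"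
proof -
  have "(\<Sum>x\<in>insert v W \<rightarrow>\<^sub>E S. F x) = (\<Sum>(a, x)\<in>S \<times> (W \<rightarrow>\<^sub>E S). F (x(v := a)))"
    unfolding PiE_insert_eq
    by (subst sum.reindex) (auto intro!: sum.cong inj_combinator assms)
  also have "\<dots> = (\<Sum>a\<in>S. \<Sum>x\<in>W \<rightarrow>\<^sub>E S. F (x(v := a)))"
    by (simp add: sum.cartesian_product)
  also have "\<dots> = (\<Sum>x\<in>W \<rightarrow>\<^sub>E S. \<Sum>a\<in>S. F (x(v := a)))"
    by (rule sum.swap)
  finally show ?thesis .
qed

lemma PiE_average_insert:
  assumes "finite W" "v \<notin> W"
  shows "PiE_average (insert v W) S F = PiE_average W S (\<lambda>x. (\<Sum>a\<in>S. F (x(v := a))) / card S)"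
  using assms by (simp add: PiE_average_def sum_PiE_insert sum_divide_distrib[symmetric] mult.commute)

lemma PiE_average_mono:
  assumes "\<And>x. x \<in> V \<rightarrow>\<^sub>E S \<Longrightarrow> F x \<le> F' x"
  shows "PiE_average V S F \<le> PiE_average V S F'"
  unfolding PiE_average_def using assms by (intro divide_right_mono sum_mono) auto

text \<open>Hoelder's inequality is applied to one vertex at a time, the factors
  containing that vertex being replaced by their partial \<open>L\<^sup>d\<close>-norms.\<close>

lemma Finner_inequality:
  fixes f :: "'v set \<Rightarrow> ('v \<Rightarrow> 'a) \<Rightarrow> real"
  assumes "finite V" "finite E" "finite S" "S \<noteq> {}" "0 < d"
    and deg: "\<And>v. v \<in> V \<Longrightarrow> card {e \<in> E. v \<in> e} \<le> d"
    and nonneg: "\<And>e x. e \<in> E \<Longrightarrow> 0 \<le> f e x"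
    and indep: "\<And>e v x a. e \<in> E \<Longrightarrow> v \<notin> e \<Longrightarrow> f e (x(v := a)) = f e x"
  shows "PiE_average V S (\<lambda>x. \<Prod>e\<in>E. f e x) \<le> (\<Prod>e\<in>E. root d (PiE_average V S (\<lambda>x. f e x ^ d)))"
  using assms(1) deg nonneg indep
proof (induction V arbitrary: f rule: finite_induct)
  case empty
  then show ?case
    using assms(5) by (auto simp: PiE_average_def real_root_power_cancel intro!: prod_mono)
next
  case (insert v W)
  have cS: "0 < real (card S)"
    using assms by (simp add: card_gt_0_iff)
  define h where "h e x = root d ((\<Sum>a\<in>S. f e (x(v := a)) ^ d) / card S)" for e x
  have h_power: "h e x ^ d = (\<Sum>a\<in>S. f e (x(v := a)) ^ d) / card S" if "e \<in> E" for e x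
    unfolding h_def using assms(5) insert.prems(2) that
    by (intro real_root_pow_pos2) (auto intro!: divide_nonneg_nonneg sum_nonneg)
  \<comment> \<open>A factor that does not depend on the coordinate \<open>v\<close> equals its own
    partial norm.\<close>
  have h_eq: "h e x = f e x" if "e \<in> E" "v \<notin> e" for e x
    using cS assms(5) insert.prems(2)[of e] insert.prems(3)[of e v x] that
    by (simp del: fun_upd_apply add: h_def real_root_power_cancel)
  have "PiE_average (insert v W) S (\<lambda>x. \<Prod>e\<in>E. f e x)
      = PiE_average W S (\<lambda>x. (\<Sum>a\<in>S. \<Prod>e\<in>E. f e (x(v := a))) / card S)"
    using insert.hyps by (rule PiE_average_insert)
  also have "\<dots> \<le> PiE_average W S (\<lambda>x. \<Prod>e\<in>E. h e x)"
  proof (rule PiE_average_mono)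
    fix x
    define D where "D = {e \<in> E. v \<in> e}"
    have D: "D \<subseteq> E" "finite D" "card D \<le> d"
      using assms(2) insert.prems(1)[of v] by (auto simp: D_def)
    \<comment> \<open>The edges avoiding \<open>v\<close> contribute a factor constant in
      \<open>a\<close>, which leaves the average; at most \<open>d\<close> factors remain for
      Hoelder.\<close>
    define P where "P = (\<Prod>e\<in>E - D. f e x)"
    have "0 \<le> P"
      unfolding P_def using insert.prems(2) by (intro prod_nonneg) auto
    have "(\<Prod>e\<in>E. f e (x(v := a))) = P * (\<Prod>e\<in>D. f e (x(v := a)))" for a
    proof -
      have "(\<Prod>e\<in>E - D. f e (x(v := a))) = P"
        unfolding P_def D_def using insert.prems(3)
        by (intro prod.cong) (auto simp del: fun_upd_apply)
      then show ?thesis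
        using prod.subset_diff[OF D(1) assms(2), of "\<lambda>e. f e (x(v := a))"] by simp
    qed
    then have "(\<Sum>a\<in>S. \<Prod>e\<in>E. f e (x(v := a))) / card S
        = P * ((\<Sum>a\<in>S. \<Prod>e\<in>D. f e (x(v := a))) / card S)"
      by (simp add: sum_distrib_left)
    also have "\<dots> \<le> P * (\<Prod>e\<in>D. h e x)"
      unfolding h_def using D assms(3-5) insert.prems(2) \<open>0 \<le> P\<close>
      by (intro mult_left_mono Hoelder_average) auto
    also have "P = (\<Prod>e\<in>E - D. h e x)"
      unfolding P_def D_def using h_eq by (intro prod.cong) auto
    also have "(\<Prod>e\<in>E - D. h e x) * (\<Prod>e\<in>D. h e x) = (\<Prod>e\<in>E. h e x)"
      using prod.subset_diff[OF D(1) assms(2), of "\<lambda>e. h e x"] by simp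
    finally show "(\<Sum>a\<in>S. \<Prod>e\<in>E. f e (x(v := a))) / card S \<le> (\<Prod>e\<in>E. h e x)" .
  qed
  also have "\<dots> \<le> (\<Prod>e\<in>E. root d (PiE_average W S (\<lambda>x. h e x ^ d)))"
  proof (rule insert.IH)
    show "0 \<le> h e x" if "e \<in> E" for e x
      unfolding h_def using that insert.prems(2)
      by (auto intro!: real_root_ge_zero divide_nonneg_nonneg sum_nonneg assms(5))
    show "h e (x(u := a)) = h e x" if "e \<in> E" "u \<notin> e" for e u x a
    proof (cases "u = v")
      case True
      then show ?thesis by (simp add: h_def)
    next
      case False
      then have "f e (x(u := a, v := b)) = f e (x(v := b))" for b
        using insert.prems(3)[OF that] by (metis fun_upd_twist)
      then show ?thesis by (simp add: h_def)
    qed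
  qed (use insert.prems(1) in auto)
  \<comment> \<open>Averaging the \<open>d\<close>-th power of a partial norm over the other
    coordinates restores the full norm.\<close>
  also have "\<dots> = (\<Prod>e\<in>E. root d (PiE_average (insert v W) S (\<lambda>x. f e x ^ d)))"
    using insert.hyps by (intro prod.cong) (auto simp: PiE_average_insert h_power)
  finally show ?case .
qed

section \<open>Homomorphism density and the norm of the weight function\<close>

text \<open>The coordinates outside \<open>vs\<close> average out, and those listed in
  \<open>vs\<close> are independent and uniform because \<open>vs\<close> has no repetition. The
  induction removes the head of \<open>vs\<close> from \<open>V\<close> and replaces
  \<open>g\<close> by its average over the first entry, so both are generalised.\<close>

lemma PiE_average_map:
  fixes g :: "'a list \<Rightarrow> real"
  assumes "finite V" "finite S" "S \<noteq> {}" "distinct vs" "set vs \<subseteq> V"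
  shows "PiE_average V S (\<lambda>x. g (map x vs))
    = (\<Sum>xs | length xs = length vs \<and> set xs \<subseteq> S. g xs) / card S ^ length vs"
  using assms(1,4,5)
proof (induction vs arbitrary: V g)
  case Nil
  have "card S \<noteq> 0" using assms by simp
  moreover have "{xs. xs = [] \<and> set xs \<subseteq> S} = {[]}" by auto
  ultimately show ?case
    using Nil by (simp add: PiE_average_def card_PiE)
next
  case (Cons w ws)
  define W where "W = V - {w}"
  have W: "finite W" "w \<notin> W" "set ws \<subseteq> W" "V = insert w W"
    using Cons.prems by (auto simp: W_def)
  have "PiE_average V S (\<lambda>x. g (map x (w # ws)))
      = PiE_average W S (\<lambda>x. (\<Sum>a\<in>S. g (map (x(w := a)) (w # ws))) / card S)"
    unfolding W(4) using W by (intro PiE_average_insert)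
  also have "\<dots> = PiE_average W S (\<lambda>x. (\<Sum>a\<in>S. g (a # map x ws)) / card S)"
    using Cons.prems by (simp add: map_fun_upd)
  also have "\<dots> = (\<Sum>xs | length xs = length ws \<and> set xs \<subseteq> S. (\<Sum>a\<in>S. g (a # xs)) / card S)
      / card S ^ length ws"
    using Cons.IH[of W "\<lambda>xs. (\<Sum>a\<in>S. g (a # xs)) / card S"] W Cons.prems by simp
  also have "(\<Sum>xs | length xs = length ws \<and> set xs \<subseteq> S. (\<Sum>a\<in>S. g (a # xs)) / card S)
      = (\<Sum>xs | length xs = length (w # ws) \<and> set xs \<subseteq> S. g xs) / card S"
  proof -
    let ?L = "{xs. length xs = length ws \<and> set xs \<subseteq> S}"
    have "{xs. length xs = length (w # ws) \<and> set xs \<subseteq> S} = (\<lambda>(xs, a). a # xs) ` (?L \<times> S)"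
      by (auto simp: length_Suc_conv image_iff)
    then have "(\<Sum>xs | length xs = length (w # ws) \<and> set xs \<subseteq> S. g xs)
        = (\<Sum>(xs, a)\<in>?L \<times> S. g (a # xs))"
      by (simp only:) (subst sum.reindex, auto simp: inj_on_def intro!: sum.cong)
    then show ?thesis
      by (simp add: sum.cartesian_product sum_divide_distrib[symmetric])
  qed
  finally show ?case
    by (simp add: mult.commute)
qed

text \<open>The choice made in \<open>edge_tuple\<close> depends on \<open>e\<close> alone, so one
  ordering serves all maps \<open>x\<close>.\<close>

lemma ex_edge_order:
  assumes "finite e"
  obtains vs where "distinct vs" "set vs = e" "\<And>x. edge_tuple x e = map x vs"
proof -
  have "\<exists>vs. distinct vs \<and> set vs = e"
    using finite_distinct_list[OF assms] by blast
  from someI_ex[OF this] show thesis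
    using that unfolding edge_tuple_def by blast
qed

lemma finite_tuples: "finite (tuples n r)"
proof -
  have "tuples n r = {xs. set xs \<subseteq> {1..n} \<and> length xs = r}"
    by (auto simp: tuples_def)
  then show ?thesis by (simp add: finite_lists_length_eq)
qed

lemma card_tuples: "card (tuples n r) = n ^ r"
proof -
  have "tuples n r = {xs. set xs \<subseteq> {1..n} \<and> length xs = r}"
    by (auto simp: tuples_def)
  then show ?thesis by (simp add: card_lists_length_eq)
qed

lemma uniform_hypergraph_finite:
  assumes "uniform_hypergraph r V E"
  shows "finite V" "finite E" "\<And>e. e \<in> E \<Longrightarrow> finite e"
  using assms unfolding uniform_hypergraph_def
  by (auto intro: finite_subset[of E "Pow V"] finite_subset[of _ V])

lemma vertex_degree_le_max_degree:
  assumes "finite V" "v \<in> V"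
  shows "card {e \<in> E. v \<in> e} \<le> max_degree V E"
  using assms unfolding max_degree_def vertex_degree_def by (intro Max_ge) auto

lemma ex_vertex_max_degree:
  assumes "finite V" "max_degree V E \<noteq> 0"
  obtains v where "v \<in> V" "card {e \<in> E. v \<in> e} = max_degree V E"
proof -
  have "max_degree V E \<in> insert 0 (vertex_degree E ` V)"
    unfolding max_degree_def using assms(1) by (intro Max_in) auto
  then show thesis
    using assms(2) that by (auto simp: vertex_degree_def)
qed

text \<open>Finner's inequality with \<open>d\<close> the maximum degree. Every edge has
  \<open>r\<close> vertices, so each factor reduces to the same average over all
  \<open>r\<close>-tuples.\<close>

lemma hom_density_le_norm:
  assumes H: "uniform_hypergraph r V E" and G: "weighted_graph r n G"
    and d: "d = max_degree V E" "0 < d" and n: "0 < n"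
  shows "hom_density V E n G \<le> root d ((\<Sum>xs\<in>tuples n r. G xs ^ d) / real n ^ r) ^ card E"
proof -
  note fin = uniform_hypergraph_finite[OF H]
  let ?S = "{1..n}"
  \<comment> \<open>The absolute value secures nonnegativity for every \<open>x\<close>, since
    \<open>G\<close> is unconstrained outside \<open>tuples n r\<close>.\<close>
  define f where "f e x = \<bar>G (edge_tuple x e)\<bar>" for e :: "'a set" and x
  have "hom_density V E n G \<le> PiE_average V ?S (\<lambda>x. \<Prod>e\<in>E. f e x)"
    unfolding hom_density_def PiE_average_def f_def abs_prod[symmetric] card_atLeastAtMost
      diff_Suc_1 by (intro divide_right_mono sum_mono) auto
  also have "\<dots> \<le> (\<Prod>e\<in>E. root d (PiE_average V ?S (\<lambda>x. f e x ^ d)))"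
  proof (rule Finner_inequality)
    show "f e (x(v := a)) = f e x" if "e \<in> E" "v \<notin> e" for e v x a
    proof -
      obtain vs where "set vs = e" "\<And>x. edge_tuple x e = map x vs"
        using ex_edge_order fin(3) \<open>e \<in> E\<close> by metis
      then show ?thesis using that by (simp add: f_def map_fun_upd)
    qed
  qed (use fin d n vertex_degree_le_max_degree in \<open>auto simp: f_def\<close>)
  also have "\<dots> = (\<Prod>e\<in>E. root d ((\<Sum>xs\<in>tuples n r. G xs ^ d) / real n ^ r))"
  proof (intro prod.cong refl arg_cong[where f = "root d"])
    fix e assume "e \<in> E"
    obtain vs where vs: "distinct vs" "set vs = e" "\<And>x. edge_tuple x e = map x vs"
      using ex_edge_order fin(3) \<open>e \<in> E\<close> by metis
    have len: "length vs = r" "set vs \<subseteq> V"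
      using vs H \<open>e \<in> E\<close> by (auto simp: uniform_hypergraph_def distinct_card[symmetric])
    have "PiE_average V ?S (\<lambda>x. f e x ^ d) = (\<Sum>xs\<in>tuples n r. \<bar>G xs\<bar> ^ d) / real n ^ r"
      using PiE_average_map[of V ?S vs "\<lambda>xs. \<bar>G xs\<bar> ^ d"] fin(1) n vs(1) len
      by (simp add: f_def vs(3) tuples_def)
    also have "(\<Sum>xs\<in>tuples n r. \<bar>G xs\<bar> ^ d) = (\<Sum>xs\<in>tuples n r. G xs ^ d)"
      using G unfolding weighted_graph_def
      by (intro sum.cong arg_cong[where f = "\<lambda>y. y ^ d"] abs_of_nonneg) blast+
    finally show "PiE_average V ?S (\<lambda>x. f e x ^ d) = (\<Sum>xs\<in>tuples n r. G xs ^ d) / real n ^ r" .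
  qed
  finally show ?thesis by simp
qed

text \<open>The norm sums over all tuples, the entropy only over increasing ones. Grouping the
  distinct tuples by their sorted version compares the two.\<close>

lemma sum_tuples_le_sorted:
  fixes h :: "nat list \<Rightarrow> real"
  assumes nonneg: "\<And>xs. xs \<in> tuples n r \<Longrightarrow> 0 \<le> h xs"
    and sym: "\<And>xs ys. xs \<in> tuples n r \<Longrightarrow> ys \<in> tuples n r \<Longrightarrow> mset xs = mset ys \<Longrightarrow> h xs = h ys"
    and diag: "\<And>xs. xs \<in> tuples n r \<Longrightarrow> \<not> distinct xs \<Longrightarrow> h xs = 0"
  shows "(\<Sum>xs\<in>tuples n r. h xs) \<le> real (r ^ r) * (\<Sum>xs | xs \<in> tuples n r \<and> sorted_wrt (<) xs. h xs)"
proof -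
  let ?D = "{xs \<in> tuples n r. distinct xs}"
  let ?I = "{xs \<in> tuples n r. sorted_wrt (<) xs}"
  have sort_in: "sort xs \<in> ?I" if "xs \<in> ?D" for xs
    using that by (auto simp: tuples_def strict_sorted_iff)
  have "(\<Sum>xs\<in>tuples n r. h xs) = (\<Sum>xs\<in>?D. h xs)"
    using diag finite_tuples by (intro sum.mono_neutral_right) auto
  also have "\<dots> = (\<Sum>ys\<in>?I. \<Sum>xs | xs \<in> ?D \<and> sort xs = ys. h xs)"
    using sort_in finite_tuples[of n r] by (intro sum.group[symmetric]) auto
  also have "\<dots> \<le> (\<Sum>ys\<in>?I. real (r ^ r) * h ys)"
  proof (rule sum_mono)
    fix ys assume ys: "ys \<in> ?I"
    let ?F = "{xs. xs \<in> ?D \<and> sort xs = ys}"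
    \<comment> \<open>Counting all lists of length \<open>r\<close> over the entries of
      \<open>ys\<close> bounds the number of rearrangements crudely by \<open>r ^ r\<close>; the
      exact \<open>r!\<close> would only improve the constant.\<close>
    let ?L = "{xs. set xs \<subseteq> set ys \<and> length xs = r}"
    have "?F \<subseteq> ?L"
      by (auto simp: tuples_def)
    then have "card ?F \<le> card ?L"
      by (intro card_mono finite_lists_length_eq) auto
    also have "\<dots> = r ^ r"
    proof -
      have "card (set ys) = r"
        using ys by (auto simp: tuples_def strict_sorted_iff distinct_card)
      then show ?thesis by (simp add: card_lists_length_eq)
    qed
    finally have card: "card ?F \<le> r ^ r" .
    have "(\<Sum>xs\<in>?F. h xs) = (\<Sum>xs\<in>?F. h ys)"
    proof (rule sum.cong)
      fix xs assume "xs \<in> ?F"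
      then show "h xs = h ys"
        using ys by (intro sym) auto
    qed simp
    also have "\<dots> \<le> real (r ^ r) * h ys"
      using card ys nonneg[of ys] by (simp del: of_nat_power add: mult_right_mono)
    finally show "(\<Sum>xs\<in>?F. h xs) \<le> real (r ^ r) * h ys" .
  qed
  finally show ?thesis by (simp add: sum_distrib_left)
qed

section \<open>Lower bounds for the relative entropy\<close>

text \<open>The inequality \<open>ln u \<le> u - 1\<close> at \<open>u = (1 - p) / (1 - x)\<close>
  bounds the second entropy term below by \<open>p - x\<close>.\<close>

lemma rel_entropy_ge:
  assumes "0 < p" "p < 1" "0 \<le> x" "x \<le> 1"
  shows "x * ln (x / p) - (x - p) \<le> rel_entropy p x"
proof (cases "x = 1")
  case False
  then have x: "0 < 1 - x" using assms by simp
  have "ln ((1 - x) / (1 - p)) = - ln ((1 - p) / (1 - x))"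
    using assms x by (simp add: ln_div)
  moreover have "ln ((1 - p) / (1 - x)) \<le> (1 - p) / (1 - x) - 1"
    using assms x by (intro ln_le_minus_one) auto
  ultimately have "(1 - x) * (1 - (1 - p) / (1 - x)) \<le> (1 - x) * ln ((1 - x) / (1 - p))"
    using x by (intro mult_left_mono) auto
  moreover have "(1 - x) * (1 - (1 - p) / (1 - x)) = p - x"
    using x by (simp add: field_simps)
  ultimately show ?thesis by (simp add: rel_entropy_def)
qed (use assms in \<open>simp add: rel_entropy_def\<close>)

lemma rel_entropy_nonneg:
  assumes "0 < p" "p < 1" "0 \<le> x" "x \<le> 1"
  shows "0 \<le> rel_entropy p x"
proof (cases "x = 0")
  case True
  then show ?thesis using rel_entropy_ge[OF assms] assms by simp
next
  case False
  then have x: "0 < x" using assms by simp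
  have "ln (p / x) \<le> p / x - 1"
    using assms x by (intro ln_le_minus_one) auto
  then have "x * (1 - p / x) \<le> x * ln (x / p)"
    using assms x by (intro mult_left_mono) (auto simp: ln_div)
  then show ?thesis
    using rel_entropy_ge[OF assms] x by (simp add: algebra_simps)
qed

text \<open>With \<open>y = x / p\<close>, the right-hand side times \<open>x\<close> is the lower
  bound of \<open>rel_entropy_ge\<close>. It vanishes at \<open>y = 1\<close>, increases from there
  on and grows like \<open>ln y\<close>, so away from 1 it dominates a multiple of
  \<open>ln y\<close>.\<close>

lemma ln_le_const_mult:
  fixes \<eta> :: real
  assumes "0 < \<eta>"
  obtains c where "0 < c" "\<And>y. 1 + \<eta> \<le> y \<Longrightarrow> c * ln y \<le> ln y - 1 + 1 / y"
proof -
  define h where "h y = ln y - 1 + 1 / y" for y :: real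
  have mono: "h y \<le> h z" if "1 \<le> y" "y \<le> z" for y z
  proof -
    have "ln (y / z) \<le> y / z - 1"
      using that by (intro ln_le_minus_one) auto
    then have "1 - y / z \<le> ln z - ln y"
      using that by (simp add: ln_div)
    moreover have "1 / y - 1 / z \<le> 1 - y / z"
    proof -
      have "(1 - y / z) - (1 / y - 1 / z) = (1 - y / z) * (1 - 1 / y)"
        using that by (simp add: field_simps)
      also have "0 \<le> \<dots>"
        using that by (intro mult_nonneg_nonneg) auto
      finally show ?thesis by simp
    qed
    ultimately show ?thesis by (simp add: h_def)
  qed
  define b where "b = h (1 + \<eta>)"
  \<comment> \<open>Strict, since equality in \<open>ln u \<le> u - 1\<close> holds only at
    \<open>u = 1\<close>; this makes \<open>b\<close> positive.\<close>
  have "ln (1 / (1 + \<eta>)) < 1 / (1 + \<eta>) - 1"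
    using assms ln_eq_minus_one[of "1 / (1 + \<eta>)"]
    by (intro order_le_neq_trans[OF ln_le_minus_one]) auto
  then have b: "0 < b"
    using assms by (simp add: b_def h_def ln_div)
  show thesis
  proof (rule that[of "min (1/2) (b / 2)"])
    fix y assume y: "1 + \<eta> \<le> y"
    then have ly: "0 < ln y" using assms by simp
    show "min (1/2) (b / 2) * ln y \<le> ln y - 1 + 1 / y"
    \<comment> \<open>From \<open>ln y = 2\<close> on, subtracting 1 costs at most half of
      \<open>ln y\<close>; below that, \<open>ln y\<close> is bounded and \<open>h y \<ge> b\<close>
      suffices.\<close>
    proof (cases "ln y \<ge> 2")
      case True
      have "min (1/2) (b / 2) * ln y \<le> 1/2 * ln y"
        using ly by (intro mult_right_mono) auto
      also have "\<dots> \<le> ln y - 1 + 1 / y"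
        using True y assms by (simp add: add_increasing2)
      finally show ?thesis .
    next
      case False
      have "min (1/2) (b / 2) * ln y \<le> (b / 2) * 2"
        using ly b False by (intro mult_mono) auto
      also have "\<dots> \<le> h y"
        using mono[of "1 + \<eta>" y] y assms by (simp add: b_def)
      finally show ?thesis by (simp add: h_def)
    qed
  qed (use b in auto)
qed

text \<open>The entropy is at least a multiple of \<open>x * ln (x / p)\<close>, so it remains to
  bound \<open>ln (x / p)\<close> below by a multiple of \<open>x * ln (1 / p)\<close>. The constant
  must be uniform in \<open>p\<close> and \<open>x\<close>.\<close>

lemma rel_entropy_ge_square:
  fixes \<eta> :: real
  assumes "0 < \<eta>"
  obtains c where "0 < c"
    "\<And>p x. 0 < p \<Longrightarrow> p < 1 \<Longrightarrow> (1 + \<eta>) * p \<le> x \<Longrightarrow> x \<le> 1 \<Longrightarrow> c * x\<^sup>2 * ln (1 / p) \<le> rel_entropy p x"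
proof -
  obtain b where b: "0 < b" "\<And>y. 1 + \<eta> \<le> y \<Longrightarrow> b * ln y \<le> ln y - 1 + 1 / y"
    using ln_le_const_mult[OF assms] by metis
  define m where "m = min (1/2) (ln (1 + \<eta>) / 2)"
  have m: "0 < m" using assms by (simp add: m_def)
  show thesis
  proof (rule that[of "b * m"])
    fix p x :: real
    assume p: "0 < p" "p < 1" and x: "(1 + \<eta>) * p \<le> x" "x \<le> 1"
    have "0 < (1 + \<eta>) * p" using p assms by simp
    then have x0: "0 < x" using x by linarith
    have y: "1 + \<eta> \<le> x / p" using x p by (simp add: field_simps)
    have lp: "0 < ln (1 / p)" using p by simp
    have key: "m * x * ln (1 / p) \<le> ln (x / p)"
    \<comment> \<open>Above \<open>sqrt p\<close>, \<open>ln (x / p)\<close> is at least half of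
      \<open>ln (1 / p)\<close>. Below it, \<open>x * ln (1 / p) \<le> 2\<close>, while
      \<open>ln (x / p)\<close> is at least \<open>ln (1 + \<eta>)\<close>. The two entries of
      \<open>m\<close> serve these two cases.\<close>
    proof (cases "sqrt p \<le> x")
      case True
      have "ln (1 / p) / 2 = ln (sqrt p / p)"
        using p by (simp add: ln_div ln_sqrt)
      also have "\<dots> \<le> ln (x / p)"
        using True p x0 by (subst ln_le_cancel_iff) (auto simp: divide_right_mono)
      finally have "ln (1 / p) / 2 \<le> ln (x / p)" .
      moreover have "m * x * ln (1 / p) \<le> 1/2 * 1 * ln (1 / p)"
        using m x0 x lp by (intro mult_right_mono mult_mono) (auto simp: m_def)
      ultimately show ?thesis by linarith
    next
      case False
      have "ln (1 / sqrt p) \<le> 1 / sqrt p - 1"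
        using p by (intro ln_le_minus_one) auto
      then have "ln (1 / p) \<le> 2 / sqrt p"
        using p by (simp add: ln_div ln_sqrt)
      then have "x * ln (1 / p) \<le> sqrt p * (2 / sqrt p)"
        using False x0 lp p by (intro mult_mono) auto
      then have "x * ln (1 / p) \<le> 2" using p by simp
      then have "m * (x * ln (1 / p)) \<le> (ln (1 + \<eta>) / 2) * 2"
        using m x0 lp by (intro mult_mono) (auto simp: m_def)
      also have "\<dots> \<le> ln (x / p)"
        using y assms by simp
      finally show ?thesis by (simp add: mult.assoc)
    qed
    have "b * m * x\<^sup>2 * ln (1 / p) = x * (b * (m * x * ln (1 / p)))"
      by (simp add: power2_eq_square)
    also have "\<dots> \<le> x * (b * ln (x / p))"
      using key b x0 by (intro mult_left_mono) auto
    also have "\<dots> \<le> x * (ln (x / p) - 1 + 1 / (x / p))"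
      using b(2)[OF y] x0 by (intro mult_left_mono) auto
    also have "\<dots> = x * ln (x / p) - (x - p)"
      using x0 p by (simp add: field_simps)
    also have "\<dots> \<le> rel_entropy p x"
      using p x x0 by (intro rel_entropy_ge) auto
    finally show "b * m * x\<^sup>2 * ln (1 / p) \<le> rel_entropy p x" .
  qed (use b m in auto)
qed

section \<open>The lower bound on the entropy\<close>

text \<open>The constant is fixed before \<open>n\<close>, \<open>p\<close> and \<open>G\<close>, so
  that passing to the infimum and to large \<open>n\<close> needs no further estimate.\<close>

lemma graph_entropy_lower_bound:
  assumes H: "uniform_hypergraph r V E" and \<Delta>: "\<Delta> = max_degree V E" "2 \<le> \<Delta>" and \<delta>: "0 < \<delta>"
  obtains c where "0 < c"
    "\<And>n p G. 0 < n \<Longrightarrow> 0 < p \<Longrightarrow> p < 1 \<Longrightarrow> weighted_graph r n G \<Longrightarrow>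
      (1 + \<delta>) * p ^ card E \<le> hom_density V E n G \<Longrightarrow>
      c * (real n ^ r * p ^ \<Delta> * ln (1 / p)) \<le> graph_entropy r n p G"
proof -
  note fin = uniform_hypergraph_finite[OF H]
  obtain v where "v \<in> V" "card {e \<in> E. v \<in> e} = \<Delta>"
    using ex_vertex_max_degree[OF fin(1), of E] \<Delta> by auto
  then obtain e where "e \<in> E" "v \<in> e"
    using \<Delta>(2) by (metis (mono_tags, lifting) card.empty empty_Collect_eq not_numeral_le_zero)
  then have E: "0 < card E" using fin by (auto simp: card_gt_0_iff)
  have r: "0 < r"
    using H \<open>e \<in> E\<close> \<open>v \<in> e\<close> fin(3) by (fastforce simp: uniform_hypergraph_def card_gt_0_iff)
  \<comment> \<open>Chosen so that the density condition reads
    \<open>(a * p) ^ card E \<le> hom_density V E n G\<close>; the norm of \<open>G\<close> is then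
    at least \<open>a * p\<close>.\<close>
  define a where "a = root (card E) (1 + \<delta>)"
  have a: "1 < a" "a ^ card E = 1 + \<delta>"
    using E \<delta> by (auto simp: a_def real_root_pow_pos)
  \<comment> \<open>The threshold \<open>1 + \<eta>\<close> lies strictly between 1 and
    \<open>a\<close>: above 1 for the entropy bound, below \<open>a\<close> so that the entries
    under \<open>(1 + \<eta>) * p\<close> cannot account for the whole norm. The deficit is
    \<open>\<gamma> * p ^ \<Delta>\<close>.\<close>
  define \<eta> where "\<eta> = (a - 1) / 2"
  have \<eta>: "0 < \<eta>" "1 + \<eta> < a" using a by (auto simp: \<eta>_def field_simps)
  define \<gamma> where "\<gamma> = a ^ \<Delta> - (1 + \<eta>) ^ \<Delta>"
  have \<gamma>: "0 < \<gamma>" unfolding \<gamma>_def using \<eta> \<Delta>(2) by (simp add: power_strict_mono)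
  obtain b where b: "0 < b" "\<And>p x. 0 < p \<Longrightarrow> p < 1 \<Longrightarrow> (1 + \<eta>) * p \<le> x \<Longrightarrow> x \<le> 1 \<Longrightarrow>
      b * x\<^sup>2 * ln (1 / p) \<le> rel_entropy p x"
    using rel_entropy_ge_square[OF \<eta>(1)] by metis
  show thesis
  proof (rule that[of "b * \<gamma> / real (r ^ r)"])
    show "0 < b * \<gamma> / real (r ^ r)" using b \<gamma> r by simp
  next
    fix n :: nat and p :: real and G
    assume n: "0 < n" and p: "0 < p" "p < 1" and G: "weighted_graph r n G"
      and t: "(1 + \<delta>) * p ^ card E \<le> hom_density V E n G"
    have lp: "0 < ln (1 / p)" using p by simp
    have G01: "0 \<le> G xs" "G xs \<le> 1" if "xs \<in> tuples n r" for xs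
      using G that unfolding weighted_graph_def by blast+
    define M where "M = (\<Sum>xs\<in>tuples n r. G xs ^ \<Delta>) / real n ^ r"
    have M0: "0 \<le> M"
      unfolding M_def using G01 by (intro divide_nonneg_nonneg sum_nonneg) auto
    have "(a * p) ^ card E \<le> root \<Delta> M ^ card E"
      using t hom_density_le_norm[OF H G \<Delta>(1)] \<Delta>(2) n a(2) by (simp add: M_def power_mult_distrib)
    then have "a * p \<le> root \<Delta> M"
      using E M0 \<Delta>(2) a(1) p(1)
      by (subst (asm) power_mono_iff) (auto intro!: mult_nonneg_nonneg real_root_ge_zero)
    then have "(a * p) ^ \<Delta> \<le> M"
      using M0 \<Delta>(2) a p power_mono[of "a * p" "root \<Delta> M" \<Delta>] by (simp add: real_root_pow_pos2)
    moreover have "M \<le> ((1 + \<eta>) * p) ^ \<Delta> + real (r ^ r) / real n ^ r * (graph_entropy r n p G / (b * ln (1 / p)))"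
    proof -
      \<comment> \<open>\<open>h\<close> keeps only the large entries; each of the others
        contributes at most \<open>((1 + \<eta>) * p) ^ \<Delta>\<close>.\<close>
      define h where "h xs = (if (1 + \<eta>) * p \<le> G xs then G xs ^ \<Delta> else 0)" for xs
      have \<eta>p: "0 < (1 + \<eta>) * p" using \<eta> p by simp
      have h0: "0 \<le> h xs" if "xs \<in> tuples n r" for xs
        using G01[OF that] by (simp add: h_def)
      have "(\<Sum>xs\<in>tuples n r. G xs ^ \<Delta>) \<le> (\<Sum>xs\<in>tuples n r. ((1 + \<eta>) * p) ^ \<Delta> + h xs)"
        using G01 \<eta>p by (intro sum_mono) (auto simp: h_def intro!: power_mono)
      also have "\<dots> = real n ^ r * ((1 + \<eta>) * p) ^ \<Delta> + (\<Sum>xs\<in>tuples n r. h xs)"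
        by (simp add: sum.distrib card_tuples)
      also have "(\<Sum>xs\<in>tuples n r. h xs)
          \<le> real (r ^ r) * (\<Sum>xs | xs \<in> tuples n r \<and> sorted_wrt (<) xs. h xs)"
      proof (rule sum_tuples_le_sorted)
        show "h xs = h ys" if "xs \<in> tuples n r" "ys \<in> tuples n r" "mset xs = mset ys" for xs ys
        proof -
          have "G xs = G ys" using G that unfolding weighted_graph_def by blast
          then show ?thesis by (simp add: h_def)
        qed
        show "h xs = 0" if "xs \<in> tuples n r" "\<not> distinct xs" for xs
        proof -
          have "G xs = 0" using G that unfolding weighted_graph_def by blast
          then show ?thesis using \<Delta>(2) by (simp add: h_def)
        qed
      qed (rule h0)
      also have "(\<Sum>xs | xs \<in> tuples n r \<and> sorted_wrt (<) xs. h xs)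
          \<le> (\<Sum>xs | xs \<in> tuples n r \<and> sorted_wrt (<) xs. rel_entropy p (G xs) / (b * ln (1 / p)))"
      proof (rule sum_mono)
        fix xs assume "xs \<in> {xs. xs \<in> tuples n r \<and> sorted_wrt (<) xs}"
        then have xs: "0 \<le> G xs" "G xs \<le> 1" using G01 by auto
        show "h xs \<le> rel_entropy p (G xs) / (b * ln (1 / p))"
        proof (cases "(1 + \<eta>) * p \<le> G xs")
          case True
          have "G xs ^ \<Delta> \<le> (G xs)\<^sup>2"
            using xs \<Delta>(2) by (intro power_decreasing) auto
          then have "h xs * (b * ln (1 / p)) \<le> (G xs)\<^sup>2 * (b * ln (1 / p))"
            using True b(1) lp by (auto simp: h_def intro!: mult_right_mono)
          also have "\<dots> \<le> rel_entropy p (G xs)"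
            using b(2)[OF p True xs(2)] by (simp add: ac_simps)
          finally show ?thesis
            using b(1) lp by (subst pos_le_divide_eq) auto
        next
          case False
          then show ?thesis
            using b(1) lp rel_entropy_nonneg[OF p xs] by (simp add: h_def)
        qed
      qed
      also have "\<dots> = graph_entropy r n p G / (b * ln (1 / p))"
        by (simp add: graph_entropy_def sum_divide_distrib)
      finally have "(\<Sum>xs\<in>tuples n r. G xs ^ \<Delta>) \<le> real n ^ r * ((1 + \<eta>) * p) ^ \<Delta>
          + real (r ^ r) * (graph_entropy r n p G / (b * ln (1 / p)))"
        by (simp add: mult_left_mono)
      then have "M \<le> (real n ^ r * ((1 + \<eta>) * p) ^ \<Delta>
          + real (r ^ r) * (graph_entropy r n p G / (b * ln (1 / p)))) / real n ^ r"
        unfolding M_def by (intro divide_right_mono) auto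
      also have "\<dots> = ((1 + \<eta>) * p) ^ \<Delta>
          + real (r ^ r) / real n ^ r * (graph_entropy r n p G / (b * ln (1 / p)))"
        using n by (simp add: add_divide_distrib)
      finally show ?thesis .
    qed
    ultimately have "\<gamma> * p ^ \<Delta> \<le> real (r ^ r) / real n ^ r * (graph_entropy r n p G / (b * ln (1 / p)))"
      unfolding \<gamma>_def power_mult_distrib left_diff_distrib by linarith
    then show "b * \<gamma> / real (r ^ r) * (real n ^ r * p ^ \<Delta> * ln (1 / p)) \<le> graph_entropy r n p G"
      using b(1) lp n r by (simp add: field_simps del: ln_div)
  qed
qed

section \<open>The hub construction and the upper bound\<close>

definition hub_graph :: "nat \<Rightarrow> real \<Rightarrow> nat list \<Rightarrow> real" where
  "hub_graph k p xs = (if \<not> distinct xs then 0 else if set xs \<inter> {1..k} \<noteq> {} then 1 else p)"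

lemma weighted_graph_hub_graph:
  assumes "0 \<le> p" "p \<le> 1"
  shows "weighted_graph r n (hub_graph k p)"
proof -
  have "hub_graph k p xs = hub_graph k p ys" if "mset xs = mset ys" for xs ys
    using mset_eq_imp_distinct_iff[OF that] mset_eq_setD[OF that] by (simp only: hub_graph_def)
  moreover have "0 \<le> hub_graph k p xs \<and> hub_graph k p xs \<le> 1" for xs
    using assms by (simp add: hub_graph_def)
  moreover have "hub_graph k p xs = 0" if "\<not> distinct xs" for xs
    using that by (simp add: hub_graph_def)
  ultimately show ?thesis
    unfolding weighted_graph_def by blast
qed

text \<open>Entries equal to \<open>p\<close> have entropy 0 and entries equal to 1 have entropy
  \<open>ln (1 / p)\<close>, so only the increasing tuples that meet a hub have to be
  counted.\<close>

lemma graph_entropy_hub_graph_le: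
  assumes "0 < p" "p < 1" "k \<le> n" "0 < r"
  shows "graph_entropy r n p (hub_graph k p) \<le> real k * real n ^ (r - 1) * ln (1 / p)"
proof -
  let ?I = "{xs \<in> tuples n r. sorted_wrt (<) xs}"
  let ?B = "{xs \<in> ?I. set xs \<inter> {1..k} \<noteq> {}}"
  have lp: "0 < ln (1 / p)" using assms by simp
  \<comment> \<open>Such a tuple is recovered by inserting one of its hubs into the sorted list of
    its other entries.\<close>
  have "?B \<subseteq> (\<lambda>(s, ys). insort s ys) ` ({1..k} \<times> tuples n (r - 1))"
  proof
    fix xs assume xs: "xs \<in> ?B"
    then obtain s where s: "s \<in> set xs" "s \<in> {1..k}" by blast
    have "insort s (remove1 s xs) = xs"
      using xs s(1) by (intro insort_remove1) (auto simp: strict_sorted_iff)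
    moreover have "remove1 s xs \<in> tuples n (r - 1)"
      using xs s(1) set_remove1_subset[of s xs] by (auto simp: tuples_def length_remove1)
    ultimately show "xs \<in> (\<lambda>(s, ys). insort s ys) ` ({1..k} \<times> tuples n (r - 1))"
      using s(2) by (intro image_eqI[of _ _ "(s, remove1 s xs)"]) auto
  qed
  then have "card ?B \<le> card ({1..k} \<times> tuples n (r - 1))"
    by (intro surj_card_le) (auto simp: finite_tuples)
  then have cB: "card ?B \<le> k * n ^ (r - 1)"
    by (simp add: card_tuples card_cartesian_product)
  have "graph_entropy r n p (hub_graph k p) = (\<Sum>xs\<in>?I. if xs \<in> ?B then ln (1 / p) else 0)"
    unfolding graph_entropy_def using assms
    by (intro sum.cong) (auto simp: hub_graph_def rel_entropy_def strict_sorted_iff)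
  also have "\<dots> = (\<Sum>xs\<in>?B. ln (1 / p))"
    using finite_tuples[of n r] by (intro sum.mono_neutral_cong_right) auto
  also have "\<dots> = real (card ?B) * ln (1 / p)"
    by simp
  also have "\<dots> \<le> real (k * n ^ (r - 1)) * ln (1 / p)"
    using cB lp by (intro mult_right_mono) (auto simp del: of_nat_mult of_nat_power)
  finally show ?thesis by simp
qed

text \<open>The image of \<open>v\<close> is one of \<open>k\<close> hubs, and the other vertices
  are then placed injectively among the remaining \<open>n - 1\<close> points. Injectivity matters
  because \<open>hub_graph\<close> vanishes on tuples with repetition.\<close>

lemma card_injective_hub_maps_ge:
  assumes "finite V" "v \<in> V" "k \<le> n" "2 * card V \<le> n"
  shows "real k * (real n / 2) ^ (card V - 1)
    \<le> real (card {x \<in> V \<rightarrow>\<^sub>E {1..n}. inj_on x V \<and> x v \<in> {1..k}})"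
proof -
  define W where "W = V - {v}"
  define m where "m = card V - 1"
  have W: "finite W" "v \<notin> W" "V = insert v W" "card W = m"
    using assms by (auto simp: W_def m_def)
  let ?J = "\<lambda>a. {y \<in> W \<rightarrow>\<^sub>E {1..n} - {a}. inj_on y W}"
  let ?X = "{x \<in> V \<rightarrow>\<^sub>E {1..n}. inj_on x V \<and> x v \<in> {1..k}}"
  have finJ: "finite (?J a)" for a
    using finite_PiE[OF W(1), of "\<lambda>_. {1..n} - {a}"] by simp
  have cardJ: "(real n / 2) ^ m \<le> real (card (?J a))" if "a \<in> {1..k}" for a
  proof -
    have ca: "card ({1..n} - {a}) = n - 1" using that assms(3) by auto
    have "card V = Suc m" using W by simp
    have "(real n / 2) ^ m = (\<Prod>i<m. real n / 2)" by simp
    \<comment> \<open>Each factor of the falling factorial is at least \<open>n - m\<close>, hence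
      at least \<open>n / 2\<close> as \<open>2 * card V \<le> n\<close>.\<close>
    also have "\<dots> \<le> (\<Prod>i<m. real (n - 1 - i))"
      using assms(4) \<open>card V = Suc m\<close> by (intro prod_mono) auto
    also have "\<dots> = real (card (?J a))"
      using W(1,4) ca
      by (subst card_inj_on_subset_funcset) (auto simp: lessThan_atLeast0)
    finally show ?thesis .
  qed
  have "real k * (real n / 2) ^ m = (\<Sum>a\<in>{1..k}. (real n / 2) ^ m)" by simp
  also have "\<dots> \<le> (\<Sum>a\<in>{1..k}. real (card (?J a)))"
    using cardJ by (intro sum_mono) auto
  also have "\<dots> = real (card (SIGMA a:{1..k}. ?J a))"
    using finJ by (subst card_SigmaI) auto
  also have "\<dots> \<le> real (card ?X)"
  proof -
    have "inj_on (\<lambda>(a, y). y(v := a)) (SIGMA a:{1..k}. ?J a)"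
      by (rule inj_on_subset[OF inj_combinator[OF W(2), of "\<lambda>_. {1..n}"]])
        (use assms(3) in \<open>auto simp: PiE_iff extensional_def\<close>)
    moreover have "(\<lambda>(a, y). y(v := a)) ` (SIGMA a:{1..k}. ?J a) \<subseteq> ?X"
      using W(2) assms(3) unfolding W(3)
      by (auto simp: PiE_iff extensional_def inj_on_def split: if_splits)
    moreover have "finite ?X"
      using assms(1) by (auto intro!: finite_PiE)
    ultimately show ?thesis by (simp add: card_inj_on_le)
  qed
  finally show ?thesis by (simp add: m_def)
qed

text \<open>Under an injective map sending \<open>v\<close> to a hub, the \<open>d\<close> edges
  through \<open>v\<close> get weight 1 and every other edge at least \<open>p\<close>.\<close>

lemma hom_density_hub_graph_ge:
  assumes H: "uniform_hypergraph r V E" and v: "v \<in> V" and d: "d = card {e \<in> E. v \<in> e}"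
    and p: "0 \<le> p" "p \<le> 1" and k: "k \<le> n" and n: "2 * card V \<le> n"
  shows "real k / real n * p ^ (card E - d) / 2 ^ (card V - 1) \<le> hom_density V E n (hub_graph k p)"
proof -
  note fin = uniform_hypergraph_finite[OF H]
  let ?G = "hub_graph k p"
  let ?X = "{x \<in> V \<rightarrow>\<^sub>E {1..n}. inj_on x V \<and> x v \<in> {1..k}}"
  have cV: "card V = Suc (card V - 1)" using card_gt_0_iff[of V] v fin(1) by fastforce
  then have n0: "0 < n" using n by linarith
  have G0: "0 \<le> ?G xs" for xs
    using p by (simp add: hub_graph_def)
  have prod_ge: "p ^ (card E - d) \<le> (\<Prod>e\<in>E. ?G (edge_tuple x e))" if x: "x \<in> ?X" for x
  proof -
    have "p ^ (card E - d) = (\<Prod>e\<in>E. if v \<in> e then 1 else p)"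
    proof -
      have "E - {e \<in> E. v \<in> e} = {e \<in> E. v \<notin> e}" by auto
      then have "card {e \<in> E. v \<notin> e} = card E - d"
        unfolding d using fin(2) card_Diff_subset[of "{e \<in> E. v \<in> e}" E] by auto
      moreover have "(\<Prod>e\<in>E. if v \<in> e then 1 else p) = (\<Prod>e\<in>{e \<in> E. v \<notin> e}. p)"
        using fin(2) by (intro prod.mono_neutral_cong_right) auto
      ultimately show ?thesis by simp
    qed
    also have "\<dots> \<le> (\<Prod>e\<in>E. ?G (edge_tuple x e))"
    proof (rule prod_mono)
      fix e assume e: "e \<in> E"
      obtain vs where vs: "distinct vs" "set vs = e" "\<And>x. edge_tuple x e = map x vs"
        using ex_edge_order fin(3) e by metis
      have "e \<subseteq> V" using H e by (auto simp: uniform_hypergraph_def)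
      then have "distinct (edge_tuple x e)"
        using x vs by (auto simp: distinct_map intro: inj_on_subset)
      moreover have "set (edge_tuple x e) \<inter> {1..k} \<noteq> {}" if "v \<in> e"
      proof -
        have "x v \<in> set (edge_tuple x e)" using vs that by auto
        then show ?thesis using x by blast
      qed
      ultimately show "0 \<le> (if v \<in> e then 1 else p) \<and> (if v \<in> e then 1 else p) \<le> ?G (edge_tuple x e)"
        using p by (auto simp: hub_graph_def)
    qed
    finally show ?thesis .
  qed
  have "(real k * (real n / 2) ^ (card V - 1)) * p ^ (card E - d) \<le> real (card ?X) * p ^ (card E - d)"
    using card_injective_hub_maps_ge[OF fin(1) v k n] p by (intro mult_right_mono) auto
  also have "\<dots> = (\<Sum>x\<in>?X. p ^ (card E - d))" by simp
  also have "\<dots> \<le> (\<Sum>x\<in>?X. \<Prod>e\<in>E. ?G (edge_tuple x e))"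
    by (intro sum_mono prod_ge)
  also have "\<dots> \<le> (\<Sum>x\<in>V \<rightarrow>\<^sub>E {1..n}. \<Prod>e\<in>E. ?G (edge_tuple x e))"
    using fin(1) G0 by (intro sum_mono2 finite_PiE prod_nonneg) auto
  finally have "(real k * (real n / 2) ^ (card V - 1)) * p ^ (card E - d) / real n ^ card V
      \<le> hom_density V E n ?G"
    unfolding hom_density_def by (intro divide_right_mono) auto
  moreover have "(real k * (real n / 2) ^ (card V - 1)) * p ^ (card E - d) / real n ^ card V
      = real k / real n * p ^ (card E - d) / 2 ^ (card V - 1)"
    using n0 by (subst (2) cV) (simp add: power_divide)
  ultimately show ?thesis by simp
qed

text \<open>\<open>K\<close> makes up for both the factor \<open>1 + \<delta>\<close> and the loss
  \<open>2 ^ (card V - 1)\<close> in the density of the hub graph, so about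
  \<open>K * n * p ^ \<Delta>\<close> hubs suffice.\<close>

lemma phi_upper_bound:
  assumes H: "uniform_hypergraph r V E" and \<Delta>: "\<Delta> = max_degree V E" "0 < \<Delta>" and \<delta>: "0 < \<delta>"
    and p: "0 < p" "p < 1" and n: "2 * card V \<le> n"
    and K: "K = (1 + \<delta>) * 2 ^ (card V - 1)" "1 \<le> real n * p ^ \<Delta>" "2 * K * p \<le> 1"
  shows "phi r V E n p \<delta> \<le> ereal (2 * K * (real n ^ r * p ^ \<Delta> * ln (1 / p)))"
proof -
  note fin = uniform_hypergraph_finite[OF H]
  obtain v where v: "v \<in> V" "card {e \<in> E. v \<in> e} = \<Delta>"
    using ex_vertex_max_degree[OF fin(1), of E] \<Delta> by auto
  then have "\<exists>e\<in>E. v \<in> e"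
    using \<Delta>(2) by (auto simp: card_gt_0_iff)
  then have r: "0 < r"
    using H fin(3) by (fastforce simp: uniform_hypergraph_def card_gt_0_iff)
  have \<Delta>E: "\<Delta> \<le> card E"
    unfolding v(2)[symmetric] using fin(2) by (intro card_mono) auto
  have K1: "1 \<le> K"
    unfolding K(1) using \<delta> mult_mono[of 1 "1 + \<delta>" 1 "2 ^ (card V - 1)"] by simp
  have n0: "0 < n" using K(2) by (cases n) auto
  have lp: "0 < ln (1 / p)" using p by simp
  \<comment> \<open>Since the rounded quantity is at least 1, rounding up at most doubles it; this
    is where \<open>1 \<le> real n * p ^ \<Delta>\<close> enters.\<close>
  define k where "k = nat \<lceil>K * (real n * p ^ \<Delta>)\<rceil>"
  have KN: "1 \<le> K * (real n * p ^ \<Delta>)"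
    using mult_mono[of 1 K 1 "real n * p ^ \<Delta>"] K1 K(2) by simp
  have k: "K * (real n * p ^ \<Delta>) \<le> real k" "real k \<le> 2 * (K * (real n * p ^ \<Delta>))"
    using KN unfolding k_def by linarith+
  \<comment> \<open>There is room for \<open>k\<close> hubs because
    \<open>p ^ \<Delta> \<le> p\<close> and \<open>2 * K * p \<le> 1\<close>.\<close>
  have "real k \<le> (2 * K * p ^ \<Delta>) * real n" using k(2) by (simp add: ac_simps)
  also have "\<dots> \<le> (2 * K * p) * real n"
    using K1 p \<Delta>(2) power_decreasing[of 1 \<Delta> p] by (intro mult_right_mono mult_left_mono) auto
  also have "\<dots> \<le> 1 * real n" using K(3) by (intro mult_right_mono) auto
  finally have kn: "k \<le> n" by simp
  let ?G = "hub_graph k p"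
  have "(1 + \<delta>) * p ^ card E = (K * (real n * p ^ \<Delta>)) / real n * p ^ (card E - \<Delta>) / 2 ^ (card V - 1)"
    using n0 \<Delta>E by (simp add: K(1) power_add[symmetric])
  also have "\<dots> \<le> real k / real n * p ^ (card E - \<Delta>) / 2 ^ (card V - 1)"
    using k(1) p by (intro divide_right_mono mult_right_mono) auto
  also have "\<dots> \<le> hom_density V E n ?G"
    using hom_density_hub_graph_ge[OF H v(1) v(2)[symmetric] _ _ kn n] p by simp
  finally have "phi r V E n p \<delta> \<le> ereal (graph_entropy r n p ?G)"
    unfolding phi_def using weighted_graph_hub_graph p by (intro INF_lower) auto
  also have "graph_entropy r n p ?G \<le> real k * real n ^ (r - 1) * ln (1 / p)"
    using p kn r by (rule graph_entropy_hub_graph_le)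
  also have "\<dots> \<le> 2 * (K * (real n * p ^ \<Delta>)) * real n ^ (r - 1) * ln (1 / p)"
    using k(2) lp by (intro mult_right_mono) auto
  also have "\<dots> = 2 * K * ((real n * real n ^ (r - 1)) * p ^ \<Delta> * ln (1 / p))"
    by (simp add: ac_simps)
  also have "real n * real n ^ (r - 1) = real n ^ r"
    using r by (metis power_minus_mult mult.commute)
  finally show ?thesis by simp
qed

section \<open>Combining the bounds along the sequence \<open>p\<close>\<close>

theorem theorem2p2:
  fixes V :: "'v set" and E :: "'v set set" and r \<Delta> :: nat
    and \<delta> :: real and p :: "nat \<Rightarrow> real"
  assumes "uniform_hypergraph r V E"
    and "\<Delta> = max_degree V E" and "\<Delta> \<ge> 2"
    and "\<delta> > 0"
    and "\<forall>\<^sub>F n in sequentially. 0 < p n \<and> p n < 1"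
    and "(\<lambda>n. real n powr (- 1 / real \<Delta>)) \<lless> p"
    and "p \<lless> (\<lambda>n. 1)"
  shows "\<exists>c C :: real. 0 < c \<and> c < C \<and>
    (\<forall>\<^sub>F n in sequentially.
       ereal (c * (real n ^ r * p n ^ \<Delta> * ln (1 / p n))) \<le> phi r V E n (p n) \<delta> \<and>
       phi r V E n (p n) \<delta> \<le> ereal (C * (real n ^ r * p n ^ \<Delta> * ln (1 / p n))))"
proof -
  obtain c where c: "0 < c" and lower: "\<And>n p G. 0 < n \<Longrightarrow> 0 < p \<Longrightarrow> p < 1 \<Longrightarrow> weighted_graph r n G \<Longrightarrow>
      (1 + \<delta>) * p ^ card E \<le> hom_density V E n G \<Longrightarrow>
      c * (real n ^ r * p ^ \<Delta> * ln (1 / p)) \<le> graph_entropy r n p G"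
    using graph_entropy_lower_bound[OF assms(1-4)] by metis
  define K where "K = (1 + \<delta>) * 2 ^ (card V - 1)"
  have K: "0 < K" using assms(4) by (simp add: K_def)
  \<comment> \<open>The entry \<open>c + 1\<close> only ensures the strict inequality
    \<open>c < C\<close>.\<close>
  define C where "C = max (c + 1) (2 * K)"
  have "\<forall>\<^sub>F n in sequentially. real n powr (- 1 / real \<Delta>) / p n < 1"
    using assms(6) unfolding much_less_def by (rule order_tendstoD) simp
  moreover have "\<forall>\<^sub>F n in sequentially. p n < 1 / (2 * K)"
    using assms(7) K unfolding much_less_def by (auto dest!: order_tendstoD(2)[of _ _ _ "1 / (2 * K)"])
  moreover have "\<forall>\<^sub>F n in sequentially. max 1 (2 * card V) \<le> n"
    by (rule eventually_ge_at_top)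
  ultimately have "\<forall>\<^sub>F n in sequentially.
       ereal (c * (real n ^ r * p n ^ \<Delta> * ln (1 / p n))) \<le> phi r V E n (p n) \<delta> \<and>
       phi r V E n (p n) \<delta> \<le> ereal (C * (real n ^ r * p n ^ \<Delta> * ln (1 / p n)))"
    using assms(5)
  proof eventually_elim
    case (elim n)
    then have p: "0 < p n" "p n < 1" and n: "0 < n" "2 * card V \<le> n" by auto
    \<comment> \<open>Raised to the power \<open>\<Delta>\<close>, the growth condition on
      \<open>p\<close> says that the number of hubs \<open>n * p ^ \<Delta>\<close> is at least
      1.\<close>
    have "real n powr (- 1 / real \<Delta>) < p n"
      using elim(1) p by (simp add: divide_simps)
    then have "(real n powr (- 1 / real \<Delta>)) ^ \<Delta> \<le> p n ^ \<Delta>"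
      by (intro power_mono) auto
    moreover have "(real n powr (- 1 / real \<Delta>)) ^ \<Delta> = 1 / real n"
      using n(1) assms(3) by (subst powr_power) (simp_all add: powr_minus_divide)
    ultimately have "1 / real n \<le> p n ^ \<Delta>"
      by (simp only:)
    then have np: "1 \<le> real n * p n ^ \<Delta>"
      using n(1) by (simp add: field_simps)
    have Kp: "2 * K * p n \<le> 1"
      using elim(2) K by (simp add: field_simps)
    have "phi r V E n (p n) \<delta> \<le> ereal (2 * K * (real n ^ r * p n ^ \<Delta> * ln (1 / p n)))"
      using assms(3) by (intro phi_upper_bound[OF assms(1,2) _ assms(4) p n(2) K_def np Kp]) simp
    also have "\<dots> \<le> ereal (C * (real n ^ r * p n ^ \<Delta> * ln (1 / p n)))"
    proof -
      have "0 \<le> real n ^ r * p n ^ \<Delta> * ln (1 / p n)"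
        using p by (intro mult_nonneg_nonneg) auto
      then show ?thesis
        unfolding ereal_less_eq by (intro mult_right_mono) (auto simp: C_def)
    qed
    finally have "phi r V E n (p n) \<delta> \<le> ereal (C * (real n ^ r * p n ^ \<Delta> * ln (1 / p n)))" .
    moreover have "ereal (c * (real n ^ r * p n ^ \<Delta> * ln (1 / p n))) \<le> phi r V E n (p n) \<delta>"
      unfolding phi_def
    proof (rule INF_greatest)
      fix G assume "G \<in> {G. weighted_graph r n G \<and> hom_density V E n G \<ge> (1 + \<delta>) * p n ^ card E}"
      then show "ereal (c * (real n ^ r * p n ^ \<Delta> * ln (1 / p n))) \<le> ereal (graph_entropy r n (p n) G)"
        unfolding ereal_less_eq using lower[OF n(1) p] by simp
    qed
    ultimately show ?case by simp
  qed
  moreover have "c < C" by (simp add: C_def)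
  ultimately show ?thesis using c by blast
qed

end
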